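(* Let $Z$ be a standard normal random variable. If $X$ and $Y$ are independent real random variables, each with mean $0$ and variance $1$, then \[ W_2\Bigl(\frac{X+Y}{\sqrt{2}}, Z\Bigr)^2 \le \frac{W_2(X,Z)^2 + W_2(Y,Z)^2}{2}. \] The equality holds if and only if both $X$ and $Y$ are standard normal.
   Context: For real random variables $X$ and $Y$ (possibly defined on different probability spaces), the $2$-Wasserstein distance between their distributions is \[ W_2(X,Y) := \inf_{X',Y'}\sqrt{\mathbf{E}\bigl[(X'-Y')^2\bigr]}, \] where the infimum is over all pairs $(X',Y')$ of random variables defined on a common probability space such that $X'$ has the same distribution as $X$ and $Y'$ has the same distribution as $Y$ (the joint distribution of $(X',Y')$ is not specified). *)

theory Defs
  imports "HOL-Probability.Probability"
begin

definition ennreal_sqrt :: "ennreal \<Rightarrow> ennreal" where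
  "ennreal_sqrt x = (if x = \<top> then \<top> else ennreal (sqrt (enn2real x)))"

text \<open>
  \<open>W2 M X N Y\<close> is the \<open>2\<close>-Wasserstein distance between the law of \<open>X\<close> on \<open>M\<close> and the law of \<open>Y\<close>
  on \<open>N\<close>.  It is \<open>\<top>\<close> if no coupling has finite cost, so the cost is a nonnegative Lebesgue
  integral and not a Bochner integral (which is \<open>0\<close> for non-integrable functions).  A definition
  cannot quantify over all types of sample spaces; the sample space type \<open>real \<times> real\<close> suffices, as
  every pair of real random variables can be transported to its joint law.  This is the lemma
  \<open>W2_le\<close> below, in which the sample space type is arbitrary.
\<close>

definition W2 :: "'a measure \<Rightarrow> ('a \<Rightarrow> real) \<Rightarrow> 'b measure \<Rightarrow> ('b \<Rightarrow> real) \<Rightarrow> ennreal" where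
  "W2 M X N Y = Inf {ennreal_sqrt (\<integral>\<^sup>+\<omega>. ennreal ((X' \<omega> - Y' \<omega>)\<^sup>2) \<partial>P) | (P :: (real \<times> real) measure) X' Y'.
     prob_space P \<and> X' \<in> borel_measurable P \<and> Y' \<in> borel_measurable P \<and>
     distr P borel X' = distr M borel X \<and> distr P borel Y' = distr N borel Y}"

lemma W2_le:
  fixes P :: "'c measure"
  assumes P: "prob_space P"
    and m[measurable]: "X' \<in> borel_measurable P" "Y' \<in> borel_measurable P"
    and d: "distr P borel X' = distr M borel X" "distr P borel Y' = distr N borel Y"
  shows "W2 M X N Y \<le> ennreal_sqrt (\<integral>\<^sup>+\<omega>. ennreal ((X' \<omega> - Y' \<omega>)\<^sup>2) \<partial>P)"
proof -
  define Q where "Q = distr P (borel \<Otimes>\<^sub>M borel) (\<lambda>\<omega>. (X' \<omega>, Y' \<omega>))"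
  have "prob_space Q"
    unfolding Q_def by (rule prob_space.prob_space_distr[OF P]) measurable
  moreover have "fst \<in> borel_measurable Q" "snd \<in> borel_measurable Q"
    unfolding Q_def by measurable
  moreover have "distr Q borel fst = distr M borel X" "distr Q borel snd = distr N borel Y"
    unfolding Q_def d[symmetric] by (simp_all add: distr_distr comp_def)
  moreover have "(\<integral>\<^sup>+\<omega>. ennreal ((X' \<omega> - Y' \<omega>)\<^sup>2) \<partial>P) = (\<integral>\<^sup>+\<omega>. ennreal ((fst \<omega> - snd \<omega>)\<^sup>2) \<partial>Q)"
    unfolding Q_def by (simp add: nn_integral_distr)
  ultimately show ?thesis
    unfolding W2_def by (intro Inf_lower CollectI exI[of _ Q] exI[of _ fst] exI[of _ snd] conjI) simp_all
qed

end

theory Submission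
  imports Defs
begin

text \<open>
  Hoeffding's formula writes \<open>E (A - B)\<^sup>2\<close> as the integral over pairs of thresholds of
  \<open>P (A \<le> min, max < B) + P (B \<le> min, max < A)\<close>.  The marginals bound the integrand from below, and
  a comonotone coupling attains this bound; conversely, a coupling of finite cost that attains it
  is comonotone.

  Take \<open>f\<close> and \<open>g\<close> monotone such that \<open>f U\<close> and \<open>g V\<close> have the laws of \<open>X\<close> and \<open>Y\<close> for
  independent standard normal \<open>U\<close> and \<open>V\<close>.  As \<open>E (f U - U) (g V - V) = 0\<close>, coupling
  \<open>(f U + g V) / sqrt 2\<close> with \<open>(U + V) / sqrt 2\<close> costs the average of the two optimal costs.
  If this coupling is optimal, then it is comonotone, and since the law of \<open>(U, V)\<close> charges every
  open rectangle, \<open>x' + y' < x + y\<close> implies \<open>f x' + g y' \<le> f x + g y\<close> for all reals.  Hence \<open>f\<close> and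
  \<open>g\<close> are affine, and by the two moment conditions they are the identity.
\<close>

section \<open>Hoeffding's formula and optimality of comonotone couplings\<close>

text \<open>The square of the difference is the area of a square of that side; at most one of the
  two squares is nonempty. Half-open intervals produce events of the form \<open>A \<le> s\<close>
  and \<open>t < B\<close>, whose probabilities match cdfs even at atoms.\<close>

lemma power2_diff_eq_nn_integral:
  fixes x y :: real
  shows "ennreal ((x - y)\<^sup>2) =
    (\<integral>\<^sup>+p. indicator ({x..<y} \<times> {x..<y}) p + indicator ({y..<x} \<times> {y..<x}) p \<partial>(lborel \<Otimes>\<^sub>M lborel))"
proof -
  have "(\<integral>\<^sup>+p. indicator ({x..<y} \<times> {x..<y}) p + indicator ({y..<x} \<times> {y..<x}) p \<partial>(lborel \<Otimes>\<^sub>M lborel)) =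
    emeasure (lborel \<Otimes>\<^sub>M lborel) ({x..<y} \<times> {x..<y}) + emeasure (lborel \<Otimes>\<^sub>M lborel) ({y..<x} \<times> {y..<x})"
    by (subst nn_integral_add) auto
  also have "\<dots> = ennreal ((x - y)\<^sup>2)"
    by (cases "x \<le> y")
      (auto simp: lborel.emeasure_pair_measure_Times ennreal_mult[symmetric] power2_eq_square algebra_simps)
  finally show ?thesis ..
qed

text \<open>The Frechet lower bound on the integrand of Hoeffding's formula. It involves only the
  two marginals, so its integral is a cost bound common to all couplings.\<close>

definition frechet_lower :: "real measure \<Rightarrow> real measure \<Rightarrow> real \<times> real \<Rightarrow> real" where
  "frechet_lower \<alpha> \<beta> p =
    max 0 (cdf \<alpha> (min (fst p) (snd p)) - cdf \<beta> (max (fst p) (snd p))) +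
    max 0 (cdf \<beta> (min (fst p) (snd p)) - cdf \<alpha> (max (fst p) (snd p)))"

lemma frechet_lower_nonneg: "0 \<le> frechet_lower \<alpha> \<beta> p"
  by (simp add: frechet_lower_def)

lemma borel_measurable_frechet_lower:
  assumes "real_distribution \<alpha>" "real_distribution \<beta>"
  shows "frechet_lower \<alpha> \<beta> \<in> borel_measurable (lborel \<Otimes>\<^sub>M lborel)"
proof -
  interpret a: cdf_distribution \<alpha> using assms(1) by (simp add: cdf_distribution_def)
  interpret b: cdf_distribution \<beta> using assms(2) by (simp add: cdf_distribution_def)
  note [measurable] = a.measurable_C b.measurable_C
  show ?thesis unfolding frechet_lower_def by measurable
qed

context prob_space
begin

lemma cdf_distr_eq_prob:
  "X \<in> borel_measurable M \<Longrightarrow> cdf (distr M borel X) x = prob {\<omega> \<in> space M. X \<omega> \<le> x}"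
  unfolding cdf_def by (subst measure_distr) (auto intro!: arg_cong[where f=prob])

context
  fixes A B :: "'a \<Rightarrow> real"
  assumes A[measurable]: "A \<in> borel_measurable M" and B[measurable]: "B \<in> borel_measurable M"
begin

text \<open>Both \<open>A \<le> s\<close> and \<open>B \<le> t\<close> contain the event that the
  two hold together, and it cancels. As the difference is fixed by the marginals, each probability
  on the left is at least a positive part of it, with equality when either probability
  vanishes.\<close>

lemma prob_diff_eq_cdf_diff:
  "prob {\<omega> \<in> space M. A \<omega> \<le> s \<and> t < B \<omega>} - prob {\<omega> \<in> space M. B \<omega> \<le> t \<and> s < A \<omega>} =
    cdf (distr M borel A) s - cdf (distr M borel B) t"
proof -
  have "prob {\<omega> \<in> space M. A \<omega> \<le> s} =
      prob ({\<omega> \<in> space M. A \<omega> \<le> s \<and> t < B \<omega>} \<union> {\<omega> \<in> space M. A \<omega> \<le> s \<and> B \<omega> \<le> t})"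
    by (intro arg_cong[where f=prob]) auto
  also have "\<dots> = prob {\<omega> \<in> space M. A \<omega> \<le> s \<and> t < B \<omega>} + prob {\<omega> \<in> space M. A \<omega> \<le> s \<and> B \<omega> \<le> t}"
    by (intro finite_measure_Union) auto
  finally have 1: "prob {\<omega> \<in> space M. A \<omega> \<le> s} = \<dots>" .
  have "prob {\<omega> \<in> space M. B \<omega> \<le> t} =
      prob ({\<omega> \<in> space M. B \<omega> \<le> t \<and> s < A \<omega>} \<union> {\<omega> \<in> space M. A \<omega> \<le> s \<and> B \<omega> \<le> t})"
    by (intro arg_cong[where f=prob]) auto
  also have "\<dots> = prob {\<omega> \<in> space M. B \<omega> \<le> t \<and> s < A \<omega>} + prob {\<omega> \<in> space M. A \<omega> \<le> s \<and> B \<omega> \<le> t}"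
    by (intro finite_measure_Union) auto
  finally show ?thesis using 1 by (simp add: cdf_distr_eq_prob)
qed

text \<open>Tonelli's theorem, applied after writing the squared difference as an area.
  Measurability of the inner integral comes along and serves the equality case.\<close>

lemma hoeffding_formula:
  "(\<integral>\<^sup>+\<omega>. ennreal ((A \<omega> - B \<omega>)\<^sup>2) \<partial>M) =
    (\<integral>\<^sup>+p. ennreal (prob {\<omega> \<in> space M. A \<omega> \<le> min (fst p) (snd p) \<and> max (fst p) (snd p) < B \<omega>} +
      prob {\<omega> \<in> space M. B \<omega> \<le> min (fst p) (snd p) \<and> max (fst p) (snd p) < A \<omega>}) \<partial>(lborel \<Otimes>\<^sub>M lborel))" (is ?eq)
  and borel_measurable_hoeffding:
  "(\<lambda>p. ennreal (prob {\<omega> \<in> space M. A \<omega> \<le> min (fst p) (snd p) \<and> max (fst p) (snd p) < B \<omega>} +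
      prob {\<omega> \<in> space M. B \<omega> \<le> min (fst p) (snd p) \<and> max (fst p) (snd p) < A \<omega>}))
    \<in> borel_measurable (lborel \<Otimes>\<^sub>M lborel)" (is ?meas)
proof -
  define h where "h \<omega> p = (indicator {\<omega> \<in> space M. A \<omega> \<le> min (fst p) (snd p) \<and> max (fst p) (snd p) < B \<omega>} \<omega> +
      indicator {\<omega> \<in> space M. B \<omega> \<le> min (fst p) (snd p) \<and> max (fst p) (snd p) < A \<omega>} \<omega> :: ennreal)" for \<omega> p
  have h[measurable]: "case_prod h \<in> borel_measurable (M \<Otimes>\<^sub>M (lborel \<Otimes>\<^sub>M lborel))"
    unfolding h_def by measurable
  interpret L: pair_sigma_finite M "lborel \<Otimes>\<^sub>M lborel :: (real \<times> real) measure"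
    by (intro pair_sigma_finite.intro sigma_finite_measure_axioms lborel_pair.sigma_finite_measure_axioms)
  have k: "(\<integral>\<^sup>+\<omega>. h \<omega> p \<partial>M) =
      ennreal (prob {\<omega> \<in> space M. A \<omega> \<le> min (fst p) (snd p) \<and> max (fst p) (snd p) < B \<omega>} +
      prob {\<omega> \<in> space M. B \<omega> \<le> min (fst p) (snd p) \<and> max (fst p) (snd p) < A \<omega>})" for p
    unfolding h_def by (subst nn_integral_add) (auto simp: emeasure_eq_measure)
  have "(\<lambda>p. \<integral>\<^sup>+\<omega>. h \<omega> p \<partial>M) \<in> borel_measurable (lborel \<Otimes>\<^sub>M lborel)"
    by measurable
  then show ?meas unfolding k .
  have hp: "indicator ({A \<omega>..<B \<omega>} \<times> {A \<omega>..<B \<omega>}) p + indicator ({B \<omega>..<A \<omega>} \<times> {B \<omega>..<A \<omega>}) p = h \<omega> p"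
    if "\<omega> \<in> space M" for \<omega> p
    using that unfolding h_def by (intro arg_cong2[where f="(+)"]) (auto simp: indicator_def mem_Times_iff)
  have "(\<integral>\<^sup>+\<omega>. ennreal ((A \<omega> - B \<omega>)\<^sup>2) \<partial>M) = (\<integral>\<^sup>+\<omega>. \<integral>\<^sup>+p. h \<omega> p \<partial>(lborel \<Otimes>\<^sub>M lborel) \<partial>M)"
    unfolding power2_diff_eq_nn_integral
    by (intro nn_integral_cong) (simp only: hp)
  also have "\<dots> = (\<integral>\<^sup>+p. \<integral>\<^sup>+\<omega>. h \<omega> p \<partial>M \<partial>(lborel \<Otimes>\<^sub>M lborel))"
    by (rule L.Fubini'[symmetric]) measurable
  finally show ?eq unfolding k .
qed

lemma frechet_lower_le_prob:
  "frechet_lower (distr M borel A) (distr M borel B) p \<le>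
      prob {\<omega> \<in> space M. A \<omega> \<le> min (fst p) (snd p) \<and> max (fst p) (snd p) < B \<omega>} +
      prob {\<omega> \<in> space M. B \<omega> \<le> min (fst p) (snd p) \<and> max (fst p) (snd p) < A \<omega>}"
proof -
  let ?m = "min (fst p) (snd p)" and ?M = "max (fst p) (snd p)"
  show ?thesis
    using prob_diff_eq_cdf_diff[of ?m ?M] prob_diff_eq_cdf_diff[of ?M ?m]
      measure_nonneg[of M "{\<omega> \<in> space M. A \<omega> \<le> ?m \<and> ?M < B \<omega>}"]
      measure_nonneg[of M "{\<omega> \<in> space M. A \<omega> \<le> ?M \<and> ?m < B \<omega>}"]
      measure_nonneg[of M "{\<omega> \<in> space M. B \<omega> \<le> ?m \<and> ?M < A \<omega>}"]
      measure_nonneg[of M "{\<omega> \<in> space M. B \<omega> \<le> ?M \<and> ?m < A \<omega>}"]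
    unfolding frechet_lower_def by (intro add_mono) linarith+
qed

lemma frechet_lower_le_cost:
  "(\<integral>\<^sup>+p. ennreal (frechet_lower (distr M borel A) (distr M borel B) p) \<partial>(lborel \<Otimes>\<^sub>M lborel)) \<le>
    (\<integral>\<^sup>+\<omega>. ennreal ((A \<omega> - B \<omega>)\<^sup>2) \<partial>M)"
  unfolding hoeffding_formula by (intro nn_integral_mono ennreal_leI frechet_lower_le_prob)

text \<open>Points of the two events for the same \<open>s\<close> and \<open>t\<close> would be
  ordered oppositely by \<open>A\<close> and \<open>B\<close>. So one event is empty, and the lower
  bound is attained at every pair of thresholds.\<close>

lemma comonotone_cost_eq:
  assumes "\<And>\<omega> \<omega>'. \<lbrakk>\<omega> \<in> space M; \<omega>' \<in> space M; A \<omega> < A \<omega>'\<rbrakk> \<Longrightarrow> B \<omega> \<le> B \<omega>'"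
  shows "(\<integral>\<^sup>+\<omega>. ennreal ((A \<omega> - B \<omega>)\<^sup>2) \<partial>M) =
    (\<integral>\<^sup>+p. ennreal (frechet_lower (distr M borel A) (distr M borel B) p) \<partial>(lborel \<Otimes>\<^sub>M lborel))"
proof -
  have "{\<omega> \<in> space M. A \<omega> \<le> s \<and> t < B \<omega>} = {} \<or> {\<omega> \<in> space M. B \<omega> \<le> t \<and> s < A \<omega>} = {}" for s t
    using assms by fastforce
  then have z: "prob {\<omega> \<in> space M. A \<omega> \<le> s \<and> t < B \<omega>} = 0 \<or> prob {\<omega> \<in> space M. B \<omega> \<le> t \<and> s < A \<omega>} = 0" for s t
    by (rule disj_forward[of "{\<omega> \<in> space M. A \<omega> \<le> s \<and> t < B \<omega>} = {}" "{\<omega> \<in> space M. B \<omega> \<le> t \<and> s < A \<omega>} = {}"])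
      (simp_all only: measure_empty)
  have "prob {\<omega> \<in> space M. A \<omega> \<le> min (fst p) (snd p) \<and> max (fst p) (snd p) < B \<omega>} +
      prob {\<omega> \<in> space M. B \<omega> \<le> min (fst p) (snd p) \<and> max (fst p) (snd p) < A \<omega>} =
      frechet_lower (distr M borel A) (distr M borel B) p" for p
  proof -
    let ?m = "min (fst p) (snd p)" and ?M = "max (fst p) (snd p)"
    show ?thesis
      using prob_diff_eq_cdf_diff[of ?m ?M] prob_diff_eq_cdf_diff[of ?M ?m] z[of ?m ?M] z[of ?M ?m]
        measure_nonneg[of M "{\<omega> \<in> space M. A \<omega> \<le> ?m \<and> ?M < B \<omega>}"]
        measure_nonneg[of M "{\<omega> \<in> space M. A \<omega> \<le> ?M \<and> ?m < B \<omega>}"]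
        measure_nonneg[of M "{\<omega> \<in> space M. B \<omega> \<le> ?m \<and> ?M < A \<omega>}"]
        measure_nonneg[of M "{\<omega> \<in> space M. B \<omega> \<le> ?M \<and> ?m < A \<omega>}"]
      unfolding frechet_lower_def by (intro arg_cong2[where f="(+)"]) linarith+
  qed
  then show ?thesis unfolding hoeffding_formula by simp
qed

text \<open>Finite equal integrals of ordered integrands force equality almost everywhere. Two
  inverted events of positive probability would make the inequality strict on an open rectangle of
  thresholds; the gaps \<open>s < s'\<close> and \<open>t < t'\<close> give it positive
  area.\<close>

lemma optimal_imp_comonotone:
  assumes opt: "(\<integral>\<^sup>+\<omega>. ennreal ((A \<omega> - B \<omega>)\<^sup>2) \<partial>M) =
      (\<integral>\<^sup>+p. ennreal (frechet_lower (distr M borel A) (distr M borel B) p) \<partial>(lborel \<Otimes>\<^sub>M lborel))"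
    and fin: "(\<integral>\<^sup>+\<omega>. ennreal ((A \<omega> - B \<omega>)\<^sup>2) \<partial>M) \<noteq> \<top>"
    and less: "s < s'" "t < t'"
  shows "prob {\<omega> \<in> space M. A \<omega> \<le> s \<and> t' \<le> B \<omega>} = 0 \<or> prob {\<omega> \<in> space M. s' \<le> A \<omega> \<and> B \<omega> \<le> t} = 0"
proof (rule ccontr)
  assume "\<not> ?thesis"
  then have pos: "0 < prob {\<omega> \<in> space M. A \<omega> \<le> s \<and> t' \<le> B \<omega>}" "0 < prob {\<omega> \<in> space M. s' \<le> A \<omega> \<and> B \<omega> \<le> t}"
    by (auto simp: less_le)
  define k where "k p = prob {\<omega> \<in> space M. A \<omega> \<le> min (fst p) (snd p) \<and> max (fst p) (snd p) < B \<omega>} +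
      prob {\<omega> \<in> space M. B \<omega> \<le> min (fst p) (snd p) \<and> max (fst p) (snd p) < A \<omega>}" for p :: "real \<times> real"
  define l where "l = frechet_lower (distr M borel A) (distr M borel B)"
  let ?L = "lborel \<Otimes>\<^sub>M lborel :: (real \<times> real) measure"
  have [measurable]: "(\<lambda>p. ennreal (k p)) \<in> borel_measurable ?L" "l \<in> borel_measurable ?L"
    unfolding k_def l_def by (auto intro!: borel_measurable_hoeffding borel_measurable_frechet_lower)
  \<comment> \<open>Since \<open>k\<close> is nonnegative, its measurability is recovered from that
    of its \<open>ennreal\<close> image.\<close>
  then have "(\<lambda>p. enn2real (ennreal (k p))) \<in> borel_measurable ?L" by measurable
  then have [measurable]: "k \<in> borel_measurable ?L" by (simp add: k_def[abs_def])
  have lk: "l p \<le> k p" "0 \<le> l p" for p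
    unfolding l_def k_def by (rule frechet_lower_le_prob frechet_lower_nonneg)+
  have I: "(\<integral>\<^sup>+p. ennreal (k p) \<partial>?L) = (\<integral>\<^sup>+p. ennreal (l p) \<partial>?L)" "(\<integral>\<^sup>+p. ennreal (l p) \<partial>?L) \<noteq> \<infinity>"
    using opt fin unfolding hoeffding_formula k_def l_def by simp_all
  then have "(\<integral>\<^sup>+p. ennreal (k p) - ennreal (l p) \<partial>?L) = 0"
    by (subst nn_integral_diff) (auto intro!: ennreal_leI lk)
  then have ae: "AE p in ?L. k p \<le> l p"
    by (subst (asm) nn_integral_0_iff_AE) (auto simp: lk ennreal_minus elim!: eventually_mono)
  have "l p < k p" if "p \<in> {s<..<s'} \<times> {t<..<t'}" for p
  proof -
    obtain a b where p: "p = (a, b)" by (cases p)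
    have 1: "prob {\<omega> \<in> space M. A \<omega> \<le> s \<and> t' \<le> B \<omega>} \<le> prob {\<omega> \<in> space M. A \<omega> \<le> a \<and> b < B \<omega>}"
      "prob {\<omega> \<in> space M. s' \<le> A \<omega> \<and> B \<omega> \<le> t} \<le> prob {\<omega> \<in> space M. B \<omega> \<le> b \<and> a < A \<omega>}"
      using that p by (auto intro!: finite_measure_mono)
    \<comment> \<open>Threshold \<open>a\<close> for \<open>A\<close> and \<open>b\<close> for
      \<open>B\<close> is the pair at which neither event is null, so both bounds are strict.
      Whichever of \<open>a\<close> and \<open>b\<close> is smaller, exactly one summand of
      \<open>k p\<close> is of this kind; the other is bounded weakly by the next fact.\<close>
    have 2: "max 0 (cdf (distr M borel A) a - cdf (distr M borel B) b) < prob {\<omega> \<in> space M. A \<omega> \<le> a \<and> b < B \<omega>}"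
      "max 0 (cdf (distr M borel B) b - cdf (distr M borel A) a) < prob {\<omega> \<in> space M. B \<omega> \<le> b \<and> a < A \<omega>}"
      using 1 pos prob_diff_eq_cdf_diff[of a b] by linarith+
    have 3: "max 0 (cdf (distr M borel A) b - cdf (distr M borel B) a) \<le> prob {\<omega> \<in> space M. A \<omega> \<le> b \<and> a < B \<omega>}"
      "max 0 (cdf (distr M borel B) a - cdf (distr M borel A) b) \<le> prob {\<omega> \<in> space M. B \<omega> \<le> a \<and> b < A \<omega>}"
      using prob_diff_eq_cdf_diff[of b a] measure_nonneg[of M "{\<omega> \<in> space M. A \<omega> \<le> b \<and> a < B \<omega>}"]
        measure_nonneg[of M "{\<omega> \<in> space M. B \<omega> \<le> a \<and> b < A \<omega>}"] by linarith+
    show ?thesis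
      using 2 3 unfolding l_def k_def frechet_lower_def p
      by (cases "a \<le> b") (auto simp: min_def max_def intro!: add_less_le_mono add_le_less_mono)
  qed
  with ae have "AE p in ?L. p \<notin> {s<..<s'} \<times> {t<..<t'}"
    by (auto elim!: eventually_mono simp: not_less[symmetric] simp del: mem_Times_iff)
  then have "emeasure ?L ({s<..<s'} \<times> {t<..<t'}) = 0"
    by (subst (asm) AE_iff_null_sets[symmetric]) auto
  then show False
    using less by (auto simp: lborel.emeasure_pair_measure_Times)
qed

end

end

section \<open>The Wasserstein distance as the cost of a comonotone coupling\<close>

lemma ennreal_sqrt_power2: "(ennreal_sqrt x)\<^sup>2 = x"
  by (cases x) (auto simp: ennreal_sqrt_def ennreal_power)

lemma ennreal_sqrt_mono: "x \<le> y \<Longrightarrow> ennreal_sqrt x \<le> ennreal_sqrt y"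
  by (auto simp: ennreal_sqrt_def top_unique intro!: ennreal_leI enn2real_mono real_sqrt_le_mono)
     (simp add: less_top)

text \<open>The comonotone cost equals the Frechet integral, which depends on the marginals alone
  and bounds the cost of every competing coupling from below.\<close>

lemma W2_eq_comonotone:
  fixes P :: "'c measure"
  assumes "prob_space P" and m: "A \<in> borel_measurable P" "B \<in> borel_measurable P"
    and d: "distr P borel A = distr M borel X" "distr P borel B = distr N borel Y"
    and comono: "\<And>\<omega> \<omega>'. \<lbrakk>\<omega> \<in> space P; \<omega>' \<in> space P; A \<omega> < A \<omega>'\<rbrakk> \<Longrightarrow> B \<omega> \<le> B \<omega>'"
  shows "(W2 M X N Y)\<^sup>2 = (\<integral>\<^sup>+\<omega>. ennreal ((A \<omega> - B \<omega>)\<^sup>2) \<partial>P)"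
proof -
  interpret P: prob_space P by fact
  have "ennreal_sqrt (\<integral>\<^sup>+\<omega>. ennreal ((A \<omega> - B \<omega>)\<^sup>2) \<partial>P) \<le> W2 M X N Y"
    unfolding W2_def
  proof (rule Inf_greatest, clarify)
    fix Q :: "(real \<times> real) measure" and X' Y'
    assume Q: "prob_space Q" "X' \<in> borel_measurable Q" "Y' \<in> borel_measurable Q"
      "distr Q borel X' = distr M borel X" "distr Q borel Y' = distr N borel Y"
    then show "ennreal_sqrt (\<integral>\<^sup>+\<omega>. ennreal ((A \<omega> - B \<omega>)\<^sup>2) \<partial>P) \<le> ennreal_sqrt (\<integral>\<^sup>+\<omega>. ennreal ((X' \<omega> - Y' \<omega>)\<^sup>2) \<partial>Q)"
      using prob_space.frechet_lower_le_cost[OF Q(1-3)] P.comonotone_cost_eq[OF m comono] d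
      by (intro ennreal_sqrt_mono) simp
  qed
  then have "W2 M X N Y = ennreal_sqrt (\<integral>\<^sup>+\<omega>. ennreal ((A \<omega> - B \<omega>)\<^sup>2) \<partial>P)"
    by (intro antisym W2_le assms)
  then show ?thesis by (simp add: ennreal_sqrt_power2)
qed

section \<open>Rigidity of monotone functions\<close>

text \<open>The additive function \<open>x \<mapsto> f x - f 0 - x * (f 1 - f 0)\<close> has period \<open>1\<close>, so it is bounded, hence zero.\<close>
lemma affine_of_equal_increments:
  fixes f :: "real \<Rightarrow> real"
  assumes "mono f" and inc: "\<And>x y h. f (x + h) - f x = f (y + h) - f y"
  shows "f x = f 0 + x * (f 1 - f 0)"
proof -
  define E where "E x = f x - f 0 - x * (f 1 - f 0)" for x
  have add: "E (x + y) = E x + E y" for x y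
    using inc[of x y 0] by (simp add: E_def algebra_simps)
  have E1: "E 1 = 0" and E0: "E 0 = 0" by (simp_all add: E_def)
  have n: "E (of_nat n * x) = of_nat n * E x" for n x
    by (induction n) (simp_all add: E0 add distrib_right)
  have Em: "E (- x) = - E x" for x
    using add[of x "-x"] E0 by simp
  have z: "E (of_int k) = 0" for k
    using n[of "nat \<bar>k\<bar>" 1] E1 Em[of "of_int k"] by (cases "k \<ge> 0") auto
  have bound: "\<bar>E x\<bar> \<le> f 1 - f 0" for x
  proof -
    have "E x = E (frac x)"
      using add[of "of_int \<lfloor>x\<rfloor>" "frac x"] by (simp add: z frac_def)
    have r: "0 \<le> frac x" "frac x \<le> 1" using frac_lt_1[of x] by auto
    define c where "c = frac x * (f 1 - f 0)"
    have "f 0 \<le> f (frac x)" "f (frac x) \<le> f 1"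
      using r \<open>mono f\<close> by (auto simp: monoD)
    moreover have "0 \<le> c" "c \<le> f 1 - f 0"
      unfolding c_def using r \<open>mono f\<close> by (auto simp: monoD intro!: mult_left_le_one_le)
    ultimately have "\<bar>E (frac x)\<bar> \<le> f 1 - f 0" unfolding E_def c_def[symmetric] by linarith
    then show ?thesis using \<open>E x = E (frac x)\<close> by simp
  qed
  have "E x = 0"
  proof (rule ccontr)
    assume "E x \<noteq> 0"
    then obtain k where "f 1 - f 0 < of_nat k * \<bar>E x\<bar>"
      using reals_Archimedean3[of "\<bar>E x\<bar>"] by auto
    then show False using bound[of "of_nat k * x"] by (simp add: n abs_mult)
  qed
  then show ?thesis by (simp add: E_def)
qed

text \<open>The function \<open>g\<close> serves as a measuring rod: comparison with one of its
  increments shows that a shorter increment of \<open>f\<close>, placed anywhere, never exceeds a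
  longer one. Ruling out jumps then gives equal increments for equal lengths.\<close>

lemma affine_of_monotone_sum:
  fixes f g :: "real \<Rightarrow> real"
  assumes H: "\<And>x y x' y'. x' + y' < x + y \<Longrightarrow> f x' + g y' \<le> f x + g y"
  shows "f x = f 0 + x * (f 1 - f 0)"
proof -
  have "f x \<le> f y" if "x \<le> y" for x y
    using H[of x 0 y 0] that by (cases "x = y") auto
  then have mono: "mono f" by (rule monoI)
  \<comment> \<open>The increment of \<open>g\<close> from \<open>0\<close> to the midpoint of
    \<open>a\<close> and \<open>b\<close> separates the two sides.\<close>
  have inc: "f (y + b) - f y \<le> f (x + a) - f x" if "b < a" for x y a b
    using H[of x "0 + (a + b) / 2" "x + a" 0] H[of "y + b" 0 y "0 + (a + b) / 2"] that
    by (simp add: field_simps)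
  \<comment> \<open>A step shorter than \<open>1 / n\<close> gains at most as much as each of the
    \<open>n\<close> cells of the unit interval, and the gains of the cells telescope.\<close>
  have small: "f (y + h) - f y \<le> (f 1 - f 0) / of_nat n" if "0 < n" "h < 1 / of_nat n" for y h n
  proof -
    have step: "f (y + h) - f y \<le> f (of_nat (Suc k) / of_nat n) - f (of_nat k / of_nat n)" for k
    proof -
      have "of_nat k / of_nat n + 1 / of_nat n = (of_nat (Suc k) / of_nat n :: real)"
        by (simp add: add_divide_distrib)
      then show ?thesis using inc[OF that(2), of y "of_nat k / of_nat n"] by (simp only:)
    qed
    have "(\<Sum>k<n. f (y + h) - f y) \<le> (\<Sum>k<n. f (of_nat (Suc k) / of_nat n) - f (of_nat k / of_nat n))"
      by (intro sum_mono step)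
    also have "\<dots> = f 1 - f 0"
      using that by (subst sum_lessThan_telescope) simp
    finally show ?thesis using that by (simp add: field_simps)
  qed
  have le: "f (y + b) - f y \<le> f (x + b) - f x" for x y b
  proof (rule field_le_epsilon)
    fix e :: real assume e: "0 < e"
    obtain n where n: "(f 1 - f 0) / e < of_nat n" "0 < n"
      using reals_Archimedean2[of "max 0 ((f 1 - f 0) / e)"] by auto
    define h where "h = 1 / (2 * real n)"
    have h: "0 < h" "h < 1 / of_nat n" using n by (auto simp: h_def field_simps)
    have "(f 1 - f 0) / of_nat n < e" using n e by (simp add: field_simps)
    \<comment> \<open>Lengthening \<open>b\<close> by \<open>h\<close> makes \<open>inc\<close>
      applicable, and the extra step gains less than \<open>e\<close> by
      \<open>small\<close>.\<close>
    then show "f (y + b) - f y \<le> f (x + b) - f x + e"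
      using small[OF n(2) h(2), of "x + b"] inc[of b "b + h" y x] h by (simp add: add.assoc)
  qed
  show ?thesis by (rule affine_of_equal_increments[OF mono]) (intro antisym le)
qed

section \<open>The standard normal law: quantile maps, independent pairs and moments\<close>

lemma distr_eq_std_normal:
  assumes "distributed M lborel X std_normal_density"
  shows "distr M borel X = std_normal_distribution"
proof -
  have "distr M borel X = distr M lborel X" by (rule distr_cong) auto
  then show ?thesis using distributed_distr_eq_density[OF assms] by simp
qed

text \<open>The density is positive everywhere. Thus the normal law has no atoms and charges every
  nondegenerate interval.\<close>

lemma std_normal_null_iff:
  assumes "S \<in> sets borel"
  shows "emeasure std_normal_distribution S = 0 \<longleftrightarrow> emeasure lborel S = 0"
proof -
  have [simp]: "\<not> std_normal_density x \<le> 0" for x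
    using normal_density_pos[of 1 0 x] by linarith
  have "emeasure std_normal_distribution S = 0 \<longleftrightarrow> (AE x in lborel. x \<notin> S)"
    using assms by (subst emeasure_density, simp, simp, subst nn_integral_0_iff_AE)
       (auto simp: indicator_def ennreal_eq_0_iff not_le[symmetric] intro!: AE_cong)
  also have "\<dots> \<longleftrightarrow> emeasure lborel S = 0"
    using assms by (subst AE_iff_null_sets[symmetric]) auto
  finally show ?thesis .
qed

text \<open>The map is the quantile function of \<mu> after the normal cdf, which turns a normal
  variable into a uniform one.\<close>

lemma ex_quantile_std_normal:
  assumes "real_distribution \<mu>"
  obtains f :: "real \<Rightarrow> real" where "mono f" "distr std_normal_distribution borel f = \<mu>"
proof -
  let ?\<gamma> = std_normal_distribution
  interpret G: cdf_distribution ?\<gamma>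
    using real_dist_normal_dist by (simp add: cdf_distribution_def)
  interpret \<mu>: cdf_distribution \<mu>
    using assms by (simp add: cdf_distribution_def)
  have cont: "isCont (cdf ?\<gamma>) x" for x
    using std_normal_null_iff[of "{x}"] by (simp add: G.isCont_cdf measure_def)
  have less: "cdf ?\<gamma> x < cdf ?\<gamma> y" if "x < y" for x y
  proof -
    have "cdf ?\<gamma> y - cdf ?\<gamma> x = measure ?\<gamma> {x<..y}"
      by (rule G.cdf_diff_eq[OF that])
    moreover have "measure ?\<gamma> {x<..y} \<noteq> 0"
      using that std_normal_null_iff[of "{x<..y}"] by (simp add: G.emeasure_eq_measure)
    ultimately show ?thesis using measure_nonneg[of ?\<gamma> "{x<..y}"] by linarith
  qed
  \<comment> \<open>The Galois property of the pseudoinverse \<open>\<mu>.I\<close> is available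
    only for arguments strictly between 0 and 1.\<close>
  have range: "0 < cdf ?\<gamma> x" "cdf ?\<gamma> x < 1" for x
    using less[of "x - 1" x] less[of x "x + 1"] G.cdf_nonneg[of "x - 1"] G.cdf_bounded_prob[of "x + 1"] by auto
  define f where "f x = \<mu>.I (cdf ?\<gamma> x)" for x
  have f_le: "f x \<le> t \<longleftrightarrow> cdf ?\<gamma> x \<le> cdf \<mu> t" for x t
    unfolding f_def by (rule \<mu>.pseudoinverse[OF range, symmetric])
  have mono: "mono f"
  proof (rule monoI)
    fix x y :: real assume "x \<le> y"
    then show "f x \<le> f y" using f_le[of x "f y"] f_le[of y "f y"] G.cdf_nondecreasing[of x y] by simp
  qed
  have [measurable]: "f \<in> borel_measurable borel" by (rule borel_measurable_mono[OF mono])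
  have "cdf (distr ?\<gamma> borel f) t = cdf \<mu> t" for t
  proof -
    have "cdf (distr ?\<gamma> borel f) t = measure ?\<gamma> {x. cdf ?\<gamma> x \<le> cdf \<mu> t}"
      unfolding cdf_def[of "distr _ _ _"] by (subst measure_distr) (auto simp: f_le intro!: arg_cong[where f="measure _"])
    also have "\<dots> = cdf \<mu> t"
    proof -
      \<comment> \<open>The normal cdf omits the values 0 and 1, so the event is empty or everything
        there. Any other value is attained at some \<open>w\<close> by continuity, and the event is
        the ray up to \<open>w\<close>.\<close>
      consider "cdf \<mu> t = 0" | "cdf \<mu> t = 1" | "0 < cdf \<mu> t" "cdf \<mu> t < 1"
        using \<mu>.cdf_nonneg[of t] \<mu>.cdf_bounded_prob[of t] by linarith
      then show ?thesis
      proof cases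
        case 1
        then have "{x. cdf ?\<gamma> x \<le> cdf \<mu> t} = {}" using range(1) by (auto simp: not_le)
        then show ?thesis using 1 by simp
      next
        case 2
        then have "{x. cdf ?\<gamma> x \<le> cdf \<mu> t} = space ?\<gamma>" using range(2) by (auto simp: less_imp_le)
        then show ?thesis using 2 G.prob_space by simp
      next
        case 3
        obtain a where a: "cdf ?\<gamma> a \<le> cdf \<mu> t"
          using order_tendstoD(2)[OF G.cdf_lim_at_bot 3(1)]
          by (metis eventually_happens' trivial_limit_at_bot_linorder less_imp_le)
        obtain b where b: "cdf \<mu> t \<le> cdf ?\<gamma> b"
          using order_tendstoD(1)[OF G.cdf_lim_at_top_prob 3(2)]
          by (metis eventually_happens' trivial_limit_at_top_linorder less_imp_le)
        have "a \<le> b \<or> b < a" by auto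
        then obtain w where w: "cdf ?\<gamma> w = cdf \<mu> t"
          using IVT[of "cdf ?\<gamma>" a "cdf \<mu> t" b] a b cont less[of b a] by force
        have "{x. cdf ?\<gamma> x \<le> cdf \<mu> t} = {..w}"
          using less[of w] G.cdf_nondecreasing[of _ w] by (auto simp: w[symmetric] not_le[symmetric])
        then show ?thesis using w by (simp add: cdf_def)
      qed
    qed
    finally show ?thesis .
  qed
  then have "distr ?\<gamma> borel f = \<mu>"
    by (intro cdf_unique ext G.real_distribution_distr assms) auto
  with mono show ?thesis by (rule that)
qed

lemma std_normal_moments:
  "integrable std_normal_distribution (\<lambda>x. x)" "integrable std_normal_distribution (\<lambda>x. x\<^sup>2)"
  "(\<integral>x. x \<partial>std_normal_distribution) = 0" "(\<integral>x. x\<^sup>2 \<partial>std_normal_distribution) = 1"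
  using integrable_std_normal_moment[of 1] integrable_std_normal_moment[of 2]
    integral_std_normal_moment_odd[of 0] integral_std_normal_moment_even[of 1]
  by (simp_all add: integrable_density integral_density)

interpretation std_normal: real_distribution std_normal_distribution
  by (rule real_dist_normal_dist)

interpretation std_normal_pair: pair_prob_space std_normal_distribution std_normal_distribution ..

lemma distr_std_normal_pair:
  "distr (std_normal_distribution \<Otimes>\<^sub>M std_normal_distribution) std_normal_distribution fst = std_normal_distribution"
  "distr (std_normal_distribution \<Otimes>\<^sub>M std_normal_distribution) std_normal_distribution snd = std_normal_distribution"
proof -
  let ?\<gamma> = std_normal_distribution
  show fst: "distr (?\<gamma> \<Otimes>\<^sub>M ?\<gamma>) ?\<gamma> fst = ?\<gamma>" by (rule std_normal.distr_pair_fst)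
  have "distr (?\<gamma> \<Otimes>\<^sub>M ?\<gamma>) ?\<gamma> snd = distr (distr (?\<gamma> \<Otimes>\<^sub>M ?\<gamma>) (?\<gamma> \<Otimes>\<^sub>M ?\<gamma>) (\<lambda>(x, y). (y, x))) ?\<gamma> fst"
    by (subst distr_distr) (auto simp: comp_def split_beta)
  also have "\<dots> = ?\<gamma>"
    using fst std_normal_pair.distr_pair_swap by simp
  finally show "distr (?\<gamma> \<Otimes>\<^sub>M ?\<gamma>) ?\<gamma> snd = ?\<gamma>" .
qed

lemma distr_std_normal_pair_fst:
  "sets K = sets borel \<Longrightarrow> distr (std_normal_distribution \<Otimes>\<^sub>M std_normal_distribution) K fst = std_normal_distribution"
  by (subst distr_std_normal_pair(1)[symmetric], rule distr_cong) auto

lemma distr_std_normal_pair_snd: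
  "sets K = sets borel \<Longrightarrow> distr (std_normal_distribution \<Otimes>\<^sub>M std_normal_distribution) K snd = std_normal_distribution"
  by (subst distr_std_normal_pair(2)[symmetric], rule distr_cong) auto

lemma indep_var_std_normal_pair: "std_normal_pair.indep_var borel fst borel snd"
  by (subst std_normal_pair.indep_var_distribution_eq)
     (auto simp: distr_std_normal_pair_fst distr_std_normal_pair_snd intro!: distr_id2[symmetric] sets_pair_measure_cong)

text \<open>Stability of the normal law: the variances add up to 2, and the scaling restores
  1.\<close>

lemma distr_std_normal_pair_sum:
  "distr (std_normal_distribution \<Otimes>\<^sub>M std_normal_distribution) borel (\<lambda>p. (fst p + snd p) / sqrt 2) =
    std_normal_distribution"
proof -
  let ?P = "std_normal_distribution \<Otimes>\<^sub>M std_normal_distribution"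
  have "distributed ?P lborel fst std_normal_density" "distributed ?P lborel snd std_normal_density"
    by (auto simp: distributed_def distr_std_normal_pair_fst distr_std_normal_pair_snd)
  then have "distributed ?P lborel (\<lambda>p. fst p + snd p) (normal_density 0 (sqrt 2))"
    using std_normal_pair.add_indep_normal[OF indep_var_std_normal_pair, of 1 1 0 0] by simp
  from std_normal_pair.normal_density_affine[OF this, of "1 / sqrt 2" 0]
  have "distributed ?P lborel (\<lambda>p. (fst p + snd p) / sqrt 2) std_normal_density"
    by simp
  then show ?thesis by (rule distr_eq_std_normal)
qed

lemma
  assumes [measurable]: "X \<in> borel_measurable M" "Y \<in> borel_measurable N" "h \<in> borel_measurable borel"
    and eq: "distr M borel X = distr N borel Y"
  shows integrable_cong_distr: "integrable M (\<lambda>\<omega>. h (X \<omega>) :: real) \<longleftrightarrow> integrable N (\<lambda>\<omega>. h (Y \<omega>))"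
    and integral_cong_distr: "(\<integral>\<omega>. h (X \<omega>) \<partial>M) = (\<integral>\<omega>. h (Y \<omega>) \<partial>N)"
  using integrable_distr_eq[of X M borel h] integrable_distr_eq[of Y N borel h]
    integral_distr[of X M borel h] integral_distr[of Y N borel h] eq by auto

text \<open>The mean kills the constant term and the second moment makes the slope 1 or -1;
  monotonicity excludes -1.\<close>

lemma distributed_of_affine_std_normal:
  assumes "mono f" and affine: "\<And>x. f x = f 0 + x * (f 1 - f 0)"
    and d: "distr std_normal_distribution borel f = distr M borel X"
    and [measurable]: "X \<in> borel_measurable M"
    and X: "(\<integral>\<omega>. X \<omega> \<partial>M) = 0" "(\<integral>\<omega>. (X \<omega>)\<^sup>2 \<partial>M) = 1"
  shows "distributed M lborel X std_normal_density"
proof -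
  let ?\<gamma> = std_normal_distribution
  define a c where "a = f 0" and "c = f 1 - f 0"
  have f: "f = (\<lambda>x. a + c * x)"
    unfolding a_def c_def by (rule ext, subst affine) (rule arg_cong2[where f="(+)"], simp_all only: mult.commute)
  have [measurable]: "f \<in> borel_measurable borel" unfolding f by measurable
  note m = std_normal_moments
  have "a = (\<integral>x. f x \<partial>?\<gamma>)" unfolding f using m std_normal.prob_space by simp
  also have "\<dots> = (\<integral>\<omega>. X \<omega> \<partial>M)"
    by (rule integral_cong_distr[where h="\<lambda>x. x", OF _ _ _ d]) measurable
  finally have a: "a = 0" using X by simp
  have "c\<^sup>2 = (\<integral>x. (f x)\<^sup>2 \<partial>?\<gamma>)" unfolding f a using m by (simp add: power_mult_distrib)
  also have "\<dots> = (\<integral>\<omega>. (X \<omega>)\<^sup>2 \<partial>M)"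
    by (rule integral_cong_distr[where h="\<lambda>x. x\<^sup>2", OF _ _ _ d]) measurable
  finally have "c = 1" using X monoD[OF \<open>mono f\<close>, of 0 1] by (simp add: c_def power2_eq_1_iff)
  then have "distr M borel X = ?\<gamma>" unfolding d[symmetric] f a by (simp add: distr_id2)
  moreover have "distr M lborel X = distr M borel X" by (rule distr_cong) auto
  ultimately show ?thesis by (auto simp: distributed_def)
qed

lemma W2_eq_0:
  assumes "prob_space M" "X \<in> borel_measurable M" "distr M borel X = distr N borel Z"
  shows "W2 M X N Z = 0"
  using W2_le[of M X X M X N Z] assms by (simp add: ennreal_sqrt_def)

lemma std_normal_pair_box_pos:
  assumes "a < b" "c < d"
  shows "0 < std_normal_pair.prob ({a<..<b} \<times> {c<..<d})"
proof -
  have "emeasure std_normal_distribution {a<..<b} \<noteq> 0" "emeasure std_normal_distribution {c<..<d} \<noteq> 0"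
    using assms by (simp_all add: std_normal_null_iff[of "{_<..<_}"])
  then have "emeasure (std_normal_distribution \<Otimes>\<^sub>M std_normal_distribution) ({a<..<b} \<times> {c<..<d}) \<noteq> 0"
    by (subst std_normal.emeasure_pair_measure_Times) auto
  then show ?thesis by (simp add: std_normal_pair.emeasure_eq_measure zero_less_measure_iff)
qed

section \<open>The inequality and its equality case\<close>

theorem theorem3:
  fixes M :: "'a measure" and X Y :: "'a \<Rightarrow> real"
    and N :: "'b measure" and Z :: "'b \<Rightarrow> real"
  assumes "prob_space N"
    and "distributed N lborel Z std_normal_density"
    and "prob_space M"
    and "prob_space.indep_var M borel X borel Y"
    and "integrable M X" and "integrable M (\<lambda>\<omega>. (X \<omega>)\<^sup>2)"
    and "prob_space.expectation M X = 0" and "prob_space.variance M X = 1"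
    and "integrable M Y" and "integrable M (\<lambda>\<omega>. (Y \<omega>)\<^sup>2)"
    and "prob_space.expectation M Y = 0" and "prob_space.variance M Y = 1"
  shows "(W2 M (\<lambda>\<omega>. (X \<omega> + Y \<omega>) / sqrt 2) N Z)\<^sup>2 \<le> ((W2 M X N Z)\<^sup>2 + (W2 M Y N Z)\<^sup>2) / 2 \<and>
    ((W2 M (\<lambda>\<omega>. (X \<omega> + Y \<omega>) / sqrt 2) N Z)\<^sup>2 = ((W2 M X N Z)\<^sup>2 + (W2 M Y N Z)\<^sup>2) / 2 \<longleftrightarrow>
      distributed M lborel X std_normal_density \<and> distributed M lborel Y std_normal_density)"
proof -
  interpret M: prob_space M by fact
  let ?\<gamma> = std_normal_distribution
  let ?P = "?\<gamma> \<Otimes>\<^sub>M ?\<gamma>"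
  let ?XY = "\<lambda>\<omega>. (X \<omega> + Y \<omega>) / sqrt 2"
  have [measurable]: "X \<in> borel_measurable M" "Y \<in> borel_measurable M"
    and XY: "distr M borel X \<Otimes>\<^sub>M distr M borel Y = distr M (borel \<Otimes>\<^sub>M borel) (\<lambda>\<omega>. (X \<omega>, Y \<omega>))"
    using assms(4) by (auto simp: M.indep_var_distribution_eq)
  have Z: "distr N borel Z = ?\<gamma>"
    by (rule distr_eq_std_normal) fact
  obtain f where f: "mono f" and df: "distr ?\<gamma> borel f = distr M borel X"
    by (rule ex_quantile_std_normal[of "distr M borel X"]) auto
  obtain g where g: "mono g" and dg: "distr ?\<gamma> borel g = distr M borel Y"
    by (rule ex_quantile_std_normal[of "distr M borel Y"]) auto
  have [measurable]: "f \<in> borel_measurable borel" "g \<in> borel_measurable borel"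
    using f g by (auto intro: borel_measurable_mono)

  \<comment> \<open>A monotone \<open>h\<close> is comonotone with the identity, so transport along
    \<open>h\<close> is optimal.\<close>
  have cost: "(W2 M X' N Z)\<^sup>2 = (\<integral>\<^sup>+x. ennreal ((h x - x)\<^sup>2) \<partial>?\<gamma>)"
    if "mono h" "distr ?\<gamma> borel h = distr M borel X'" for h X'
    using that by (intro W2_eq_comonotone[of ?\<gamma> h "\<lambda>x. x"] std_normal.prob_space_axioms)
      (auto simp: Z distr_id2 borel_measurable_mono dest: mono_invE[OF that(1)])

  define u v where "u x = f x - x" and "v x = g x - x" for x
  have [measurable]: "u \<in> borel_measurable borel" "v \<in> borel_measurable borel"
    unfolding u_def v_def by measurable
  have mom: "integrable ?\<gamma> h" "(\<integral>x. h x \<partial>?\<gamma>) = 0" "integrable ?\<gamma> (\<lambda>x. (h x)\<^sup>2)"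
    if "distr ?\<gamma> borel h = distr M borel X'" "X' \<in> borel_measurable M" "h \<in> borel_measurable borel"
      "integrable M X'" "integrable M (\<lambda>\<omega>. (X' \<omega>)\<^sup>2)" "M.expectation X' = 0" for h :: "real \<Rightarrow> real" and X'
  proof -
    note [measurable] = that(2,3)
    have "integrable ?\<gamma> h \<longleftrightarrow> integrable M X'"
      by (rule integrable_cong_distr[where h="\<lambda>x. x", OF _ _ _ that(1)]) measurable
    then show "integrable ?\<gamma> h" using that(4) ..
    have "(\<integral>x. h x \<partial>?\<gamma>) = M.expectation X'"
      by (rule integral_cong_distr[where h="\<lambda>x. x", OF _ _ _ that(1)]) measurable
    then show "(\<integral>x. h x \<partial>?\<gamma>) = 0" using that(6) by (rule trans)
    have "integrable ?\<gamma> (\<lambda>x. (h x)\<^sup>2) \<longleftrightarrow> integrable M (\<lambda>\<omega>. (X' \<omega>)\<^sup>2)"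
      by (rule integrable_cong_distr[where h="\<lambda>x. x\<^sup>2", OF _ _ _ that(1)]) measurable
    then show "integrable ?\<gamma> (\<lambda>x. (h x)\<^sup>2)" using that(5) ..
  qed
  have diff: "integrable ?\<gamma> (\<lambda>x. h x - x)" "(\<integral>x. h x - x \<partial>?\<gamma>) = 0" "integrable ?\<gamma> (\<lambda>x. (h x - x)\<^sup>2)"
    if "integrable ?\<gamma> h" "(\<integral>x. h x \<partial>?\<gamma>) = 0" "integrable ?\<gamma> (\<lambda>x. (h x)\<^sup>2)" for h
  proof -
    note m = std_normal_moments
    show "integrable ?\<gamma> (\<lambda>x. h x - x)" "(\<integral>x. h x - x \<partial>?\<gamma>) = 0" using that m by simp_all
    have [measurable]: "h \<in> borel_measurable ?\<gamma>" using that(1) by simp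
    show "integrable ?\<gamma> (\<lambda>x. (h x - x)\<^sup>2)"
    proof (rule Bochner_Integration.integrable_bound)
      show "integrable ?\<gamma> (\<lambda>x. 2 * (h x)\<^sup>2 + 2 * x\<^sup>2)" using that m by simp
      have "(h x - x)\<^sup>2 \<le> 2 * (h x)\<^sup>2 + 2 * x\<^sup>2" for x
        using zero_le_power2[of "h x + x"] by (simp add: power2_eq_square algebra_simps)
      then show "AE x in ?\<gamma>. norm ((h x - x)\<^sup>2) \<le> norm (2 * (h x)\<^sup>2 + 2 * x\<^sup>2)" by simp
    qed measurable
  qed
  have uv: "integrable ?\<gamma> u" "(\<integral>x. u x \<partial>?\<gamma>) = 0" "integrable ?\<gamma> (\<lambda>x. (u x)\<^sup>2)"
    "integrable ?\<gamma> v" "(\<integral>x. v x \<partial>?\<gamma>) = 0" "integrable ?\<gamma> (\<lambda>x. (v x)\<^sup>2)"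
    unfolding u_def v_def using assms df dg by (auto intro!: diff mom)
  \<comment> \<open>Finite second moments make both optimal costs finite. They become real numbers,
    and the finiteness is used again in the equality case.\<close>
  define a b where "a = (\<integral>x. (u x)\<^sup>2 \<partial>?\<gamma>)" and "b = (\<integral>x. (v x)\<^sup>2 \<partial>?\<gamma>)"
  have ab: "0 \<le> a" "0 \<le> b" by (simp_all add: a_def b_def)
  have W: "(W2 M X N Z)\<^sup>2 = ennreal a" "(W2 M Y N Z)\<^sup>2 = ennreal b"
    using cost[OF f df] cost[OF g dg] uv
    by (simp_all add: a_def b_def u_def[symmetric] v_def[symmetric] nn_integral_eq_integral)
  have avg: "((W2 M X N Z)\<^sup>2 + (W2 M Y N Z)\<^sup>2) / 2 = ennreal ((a + b) / 2)"
    using ab unfolding W by (simp add: ennreal_plus[symmetric] ennreal_divide_numeral del: ennreal_plus)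

  define S T where "S p = (fst p + snd p) / sqrt 2" and "T p = (f (fst p) + g (snd p)) / sqrt 2" for p
  have [measurable]: "S \<in> borel_measurable ?P" "T \<in> borel_measurable ?P"
    unfolding S_def T_def by measurable
  have dS: "distr ?P borel S = distr N borel Z"
    unfolding Z S_def by (rule distr_std_normal_pair_sum)
  \<comment> \<open>Independence makes the joint law of \<open>X\<close> and \<open>Y\<close> a
    product, hence the image of the normal pair under \<open>f\<close> and \<open>g\<close> applied
    coordinatewise.\<close>
  have "distr M (borel \<Otimes>\<^sub>M borel) (\<lambda>\<omega>. (X \<omega>, Y \<omega>)) = distr ?P (borel \<Otimes>\<^sub>M borel) (\<lambda>(x, y). (f x, g y))"
    unfolding XY[symmetric] df[symmetric] dg[symmetric]
    by (rule pair_measure_distr)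
       (auto simp: dg intro!: prob_space_imp_sigma_finite M.prob_space_distr)
  then have "distr (distr M (borel \<Otimes>\<^sub>M borel) (\<lambda>\<omega>. (X \<omega>, Y \<omega>))) borel (\<lambda>p. (fst p + snd p) / sqrt 2) =
      distr (distr ?P (borel \<Otimes>\<^sub>M borel) (\<lambda>(x, y). (f x, g y))) borel (\<lambda>p. (fst p + snd p) / sqrt 2)"
    by simp
  then have dT: "distr ?P borel T = distr M borel ?XY"
    by (simp add: distr_distr comp_def T_def[abs_def] split_beta)

  have fs: "integrable ?P (\<lambda>p. h (fst p)) = integrable ?\<gamma> h" "(\<integral>p. h (fst p) \<partial>?P) = (\<integral>x. h x \<partial>?\<gamma>)"
      "integrable ?P (\<lambda>p. h (snd p)) = integrable ?\<gamma> h" "(\<integral>p. h (snd p) \<partial>?P) = (\<integral>x. h x \<partial>?\<gamma>)"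
    if "h \<in> borel_measurable borel" for h :: "real \<Rightarrow> real"
    using that integrable_distr_eq[of fst ?P borel h] integrable_distr_eq[of snd ?P borel h]
      integral_distr[of fst ?P borel h] integral_distr[of snd ?P borel h]
    by (simp_all add: distr_std_normal_pair_fst distr_std_normal_pair_snd)
  have "std_normal_pair.indep_var borel (u \<circ> fst) borel (v \<circ> snd)"
    by (rule std_normal_pair.indep_var_compose[OF indep_var_std_normal_pair]) measurable
  then have ind: "std_normal_pair.indep_var borel (\<lambda>p. u (fst p)) borel (\<lambda>p. v (snd p))"
    by (simp add: comp_def)
  \<comment> \<open>The displacements \<open>u\<close> and \<open>v\<close> of independent
    coordinates are independent with mean 0, so the mixed term drops out of the cost.\<close>
  have cross: "integrable ?P (\<lambda>p. u (fst p) * v (snd p))" "(\<integral>p. u (fst p) * v (snd p) \<partial>?P) = 0"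
    using uv fs std_normal_pair.indep_var_integrable[OF ind] std_normal_pair.indep_var_lebesgue_integral[OF ind]
    by auto
  have TS: "(T p - S p)\<^sup>2 = ((u (fst p))\<^sup>2 + (v (snd p))\<^sup>2) / 2 + u (fst p) * v (snd p)" for p
  proof -
    have "T p - S p = (u (fst p) + v (snd p)) / sqrt 2"
      by (simp add: T_def S_def u_def v_def diff_divide_distrib add_divide_distrib)
    then show ?thesis by (simp add: power_divide power2_sum add_divide_distrib)
  qed
  have sq: "integrable ?P (\<lambda>p. (u (fst p))\<^sup>2)" "integrable ?P (\<lambda>p. (v (snd p))\<^sup>2)"
    "(\<integral>p. (u (fst p))\<^sup>2 \<partial>?P) = a" "(\<integral>p. (v (snd p))\<^sup>2 \<partial>?P) = b"
    using uv fs(1,2)[of "\<lambda>x. (u x)\<^sup>2"] fs(3,4)[of "\<lambda>x. (v x)\<^sup>2"] by (simp_all add: a_def b_def)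
  have costTS: "(\<integral>\<^sup>+p. ennreal ((T p - S p)\<^sup>2) \<partial>?P) = ennreal ((a + b) / 2)"
  proof (subst nn_integral_eq_integral)
    show "integrable ?P (\<lambda>p. (T p - S p)\<^sup>2)"
      unfolding TS using sq cross by simp
    have "(\<integral>p. (T p - S p)\<^sup>2 \<partial>?P) = (a + b) / 2"
      unfolding TS using sq cross by simp
    then show "ennreal (\<integral>p. (T p - S p)\<^sup>2 \<partial>?P) = ennreal ((a + b) / 2)" by (simp only:)
  qed simp

  have "W2 M ?XY N Z \<le> ennreal_sqrt (\<integral>\<^sup>+p. ennreal ((T p - S p)\<^sup>2) \<partial>?P)"
    by (rule W2_le[OF std_normal_pair.prob_space_axioms _ _ dT dS]) measurable
  then have le: "(W2 M ?XY N Z)\<^sup>2 \<le> ennreal ((a + b) / 2)"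
    using power_mono[of "W2 M ?XY N Z" "ennreal_sqrt (ennreal ((a + b) / 2))" 2]
    unfolding costTS by (simp add: ennreal_sqrt_power2)

  have normal: "distributed M lborel X std_normal_density \<and> distributed M lborel Y std_normal_density"
    if eq: "(W2 M ?XY N Z)\<^sup>2 = ennreal ((a + b) / 2)"
  proof -
    have "real_distribution (distr M borel ?XY)" by (rule M.real_distribution_distr) measurable
    then obtain q where q: "mono q" and dq: "distr ?\<gamma> borel q = distr M borel ?XY"
      by (rule ex_quantile_std_normal)
    have [measurable]: "q \<in> borel_measurable borel" using q by (rule borel_measurable_mono)
    \<comment> \<open>The quantile coupling of the normalized sum identifies the squared distance
      with the Frechet integral. Under the assumed equality, the pair \<open>T\<close>,
      \<open>S\<close> therefore attains that bound.\<close>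
    have "(\<integral>\<^sup>+x. ennreal ((q x - x)\<^sup>2) \<partial>?\<gamma>) =
      (\<integral>\<^sup>+p. ennreal (frechet_lower (distr ?\<gamma> borel q) (distr ?\<gamma> borel (\<lambda>x. x)) p) \<partial>(lborel \<Otimes>\<^sub>M lborel))"
      by (rule std_normal.comonotone_cost_eq) (auto dest: mono_invE[OF q])
    then have opt: "(\<integral>\<^sup>+p. ennreal ((T p - S p)\<^sup>2) \<partial>?P) =
      (\<integral>\<^sup>+p. ennreal (frechet_lower (distr ?P borel T) (distr ?P borel S) p) \<partial>(lborel \<Otimes>\<^sub>M lborel))"
      unfolding costTS eq[symmetric] cost[OF q dq] by (simp add: dq dT dS Z distr_id2)
    have H: "f x' + g y' \<le> f x + g y" if less: "x' + y' < x + y" for x y x' y'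
    proof (rule ccontr)
      assume "\<not> ?thesis"
      then have less': "(f x + g y) / sqrt 2 < (f x' + g y') / sqrt 2"
        by (simp add: divide_strict_right_mono)
      \<comment> \<open>With a gap of \<open>8 * d\<close> between the sums, boxes of side
        \<open>d\<close> below \<open>(x, y)\<close> and above \<open>(x', y')\<close> still have
        sums at least \<open>4 * d\<close> apart. On these boxes monotonicity of \<open>f\<close>
        and \<open>g\<close> keeps \<open>T\<close> in the opposite order, so both inverted events
        have positive probability.\<close>
      define d where "d = (x + y - (x' + y')) / 8"
      have d: "0 < d" using less by (simp add: d_def)
      let ?A = "{p \<in> space ?P. T p \<le> (f x + g y) / sqrt 2 \<and> (x + y - 2 * d) / sqrt 2 \<le> S p}"
      let ?B = "{p \<in> space ?P. (f x' + g y') / sqrt 2 \<le> T p \<and> S p \<le> (x' + y' + 2 * d) / sqrt 2}"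
      have less'': "(x' + y' + 2 * d) / sqrt 2 < (x + y - 2 * d) / sqrt 2"
        using less by (intro divide_strict_right_mono) (auto simp: d_def field_simps)
      have z: "std_normal_pair.prob ?A = 0 \<or> std_normal_pair.prob ?B = 0"
        by (rule std_normal_pair.optimal_imp_comonotone[OF _ _ opt _ less' less'']) (auto simp: costTS)
      have "{x-d<..<x} \<times> {y-d<..<y} \<subseteq> ?A"
      proof (rule subsetI)
        fix p assume p: "p \<in> {x-d<..<x} \<times> {y-d<..<y}"
        then have "f (fst p) \<le> f x" "g (snd p) \<le> g y"
          by (auto intro!: monoD[OF f] monoD[OF g])
        then have "T p \<le> (f x + g y) / sqrt 2" "(x + y - 2 * d) / sqrt 2 \<le> S p"
          unfolding T_def S_def using p by (auto intro!: divide_right_mono)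
        then show "p \<in> ?A" by (simp add: space_pair_measure)
      qed
      then have "std_normal_pair.prob ({x-d<..<x} \<times> {y-d<..<y}) \<le> std_normal_pair.prob ?A"
        by (rule std_normal_pair.finite_measure_mono) measurable
      moreover have "{x'<..<x'+d} \<times> {y'<..<y'+d} \<subseteq> ?B"
      proof (rule subsetI)
        fix p assume p: "p \<in> {x'<..<x'+d} \<times> {y'<..<y'+d}"
        then have "f x' \<le> f (fst p)" "g y' \<le> g (snd p)"
          by (auto intro!: monoD[OF f] monoD[OF g])
        then have "(f x' + g y') / sqrt 2 \<le> T p" "S p \<le> (x' + y' + 2 * d) / sqrt 2"
          unfolding T_def S_def using p by (auto intro!: divide_right_mono)
        then show "p \<in> ?B" by (simp add: space_pair_measure)
      qed
      then have "std_normal_pair.prob ({x'<..<x'+d} \<times> {y'<..<y'+d}) \<le> std_normal_pair.prob ?B"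
        by (rule std_normal_pair.finite_measure_mono) measurable
      moreover have "0 < std_normal_pair.prob ({x-d<..<x} \<times> {y-d<..<y})"
        "0 < std_normal_pair.prob ({x'<..<x'+d} \<times> {y'<..<y'+d})"
        using d by (auto intro!: std_normal_pair_box_pos)
      ultimately show False using z by linarith
    qed
    have fa: "f x = f 0 + x * (f 1 - f 0)" for x by (rule affine_of_monotone_sum[OF H])
    have ga: "g x = g 0 + x * (g 1 - g 0)" for x
      by (rule affine_of_monotone_sum[of g f]) (use H in \<open>simp add: add.commute\<close>)
    have "M.expectation (\<lambda>\<omega>. (X \<omega>)\<^sup>2) = 1" "M.expectation (\<lambda>\<omega>. (Y \<omega>)\<^sup>2) = 1"
      using assms by simp_all
    then show ?thesis
      using assms(7,11) distributed_of_affine_std_normal[OF f fa df]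
        distributed_of_affine_std_normal[OF g ga dg] \<open>X \<in> borel_measurable M\<close> \<open>Y \<in> borel_measurable M\<close>
      by blast
  qed

  \<comment> \<open>If both laws are normal, the right-hand side is 0, and the inequality forces the
    left-hand side to be 0 as well.\<close>
  have "(W2 M ?XY N Z)\<^sup>2 = ennreal ((a + b) / 2)"
    if n: "distributed M lborel X std_normal_density" "distributed M lborel Y std_normal_density"
  proof -
    have "distr M borel X = distr N borel Z" "distr M borel Y = distr N borel Z"
      using n unfolding Z by (auto intro: distr_eq_std_normal)
    then have "ennreal ((a + b) / 2) = 0"
      unfolding avg[symmetric] by (simp add: W2_eq_0 M.prob_space_axioms)
    then show ?thesis using le by simp
  qed
  then show ?thesis using le normal unfolding avg by blast
qed

end
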